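(* If $p$ is an odd prime, then $I(2p)=2$; that is, every transitive permutation group $G$ of degree $2p$ satisfies $\rho(G)\leq 2$, and there is a transitive group of degree $2p$ with $\rho(G)=2$.
   Context: Let $G\leq\mathrm{Sym}(\Omega)$ be a finite permutation group. Two permutations $\sigma,\pi\in G$ are intersecting if $\omega^\sigma=\omega^\pi$ for some $\omega\in\Omega$; a subset $\mathcal{F}\subseteq G$ is intersecting if any two of its elements are intersecting. The intersection density is $\rho(G)=\max\{|\mathcal{F}|:\mathcal{F}\subseteq G\text{ intersecting}\}/\max_{\omega\in\Omega}|G_\omega|$, where $G_\omega$ is the stabilizer of $\omega$. For $n\in\mathbb{N}$, $I(n)=\max\{\rho(G): G \text{ transitive of degree } n\}$. *)

theory Defs
  imports Complex_Main "HOL-Algebra.Group_Action" "HOL-Computational_Algebra.Primes"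
begin

text \<open>
  Permutations of \<Omega> are the elements of the library group \<^term>\<open>BijGroup \<Omega>\<close>: bijections of \<Omega>,
  extensional outside \<Omega>. The library composes them as functions, the opposite of the
  right-action convention \<open>\<omega>\<^sup>\<sigma>\<close>; both conventions have the same subgroups, orbits,
  point stabilizers and intersecting sets.
\<close>

definition perm_group :: "'a set \<Rightarrow> ('a \<Rightarrow> 'a) set \<Rightarrow> bool" where
  "perm_group \<Omega> G \<longleftrightarrow> finite \<Omega> \<and> subgroup G (BijGroup \<Omega>)"

abbreviation perm_monoid :: "'a set \<Rightarrow> ('a \<Rightarrow> 'a) set \<Rightarrow> ('a \<Rightarrow> 'a) monoid" where
  "perm_monoid \<Omega> G \<equiv> (BijGroup \<Omega>)\<lparr>carrier := G\<rparr>"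

definition transitive_perm_group :: "'a set \<Rightarrow> ('a \<Rightarrow> 'a) set \<Rightarrow> bool" where
  "transitive_perm_group \<Omega> G \<longleftrightarrow>
     perm_group \<Omega> G \<and> transitive_action (perm_monoid \<Omega> G) \<Omega> (\<lambda>g. g)"

definition intersecting_perms :: "'a set \<Rightarrow> ('a \<Rightarrow> 'a) \<Rightarrow> ('a \<Rightarrow> 'a) \<Rightarrow> bool" where
  "intersecting_perms \<Omega> \<sigma> \<pi> \<longleftrightarrow> (\<exists>\<omega>\<in>\<Omega>. \<sigma> \<omega> = \<pi> \<omega>)"

definition intersecting :: "'a set \<Rightarrow> ('a \<Rightarrow> 'a) set \<Rightarrow> bool" where
  "intersecting \<Omega> F \<longleftrightarrow> (\<forall>\<sigma>\<in>F. \<forall>\<pi>\<in>F. intersecting_perms \<Omega> \<sigma> \<pi>)"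

definition intersection_density :: "'a set \<Rightarrow> ('a \<Rightarrow> 'a) set \<Rightarrow> real" where
  "intersection_density \<Omega> G =
     real (Max {card F |F. F \<subseteq> G \<and> intersecting \<Omega> F}) /
     real (Max {card (stabilizer (perm_monoid \<Omega> G) (\<lambda>g. g) \<omega>) |\<omega>. \<omega> \<in> \<Omega>})"

text \<open>
  A definition cannot quantify over all types, so the groups of degree \<open>n\<close> are collected on
  \<open>n\<close>-element sets of natural numbers; every permutation group of degree \<open>n\<close> is isomorphic,
  as a permutation group, to one of these.
\<close>

definition transitive_densities :: "nat \<Rightarrow> real set" where
  "transitive_densities n =
     {intersection_density \<Omega> G |(\<Omega> :: nat set) G. transitive_perm_group \<Omega> G \<and> card \<Omega> = n}"

definition max_intersection_density :: "nat \<Rightarrow> real" where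
  "max_intersection_density n = Max (transitive_densities n)"

lemma perm_group_imp_group:
  assumes "perm_group \<Omega> G"
  shows "group (perm_monoid \<Omega> G)"
  by (rule group.subgroup_imp_group[OF group_BijGroup]) (use assms in \<open>simp add: perm_group_def\<close>)

lemma transitive_perm_group_iff:
  "transitive_perm_group \<Omega> G \<longleftrightarrow>
     perm_group \<Omega> G \<and> (\<forall>x\<in>\<Omega>. \<forall>y\<in>\<Omega>. \<exists>g\<in>G. g x = y)"
proof (cases "perm_group \<Omega> G")
  case True
  have "(\<lambda>g. g) \<in> hom (perm_monoid \<Omega> G) (BijGroup \<Omega>)"
    using True by (auto simp: perm_group_def hom_def dest: subgroup.mem_carrier)
  then have "group_action (perm_monoid \<Omega> G) \<Omega> (\<lambda>g. g)"
    using perm_group_imp_group[OF True] group_BijGroup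
    by (simp add: group_action_def group_hom_def group_hom_axioms_def)
  then show ?thesis
    using True
    by (auto simp: transitive_perm_group_def transitive_action_def transitive_action_axioms_def)
next
  case False
  then show ?thesis
    by (simp add: transitive_perm_group_def)
qed

lemma Bij_subset_PiE: "Bij \<Omega> \<subseteq> \<Omega> \<rightarrow>\<^sub>E \<Omega>"
  by (auto simp: Bij_def PiE_def bij_betw_def)

lemma perm_group_subset_PiE:
  assumes "perm_group \<Omega> G"
  shows "G \<subseteq> \<Omega> \<rightarrow>\<^sub>E \<Omega>"
  using assms Bij_subset_PiE[of \<Omega>] subgroup.subset[of G "BijGroup \<Omega>"]
  by (auto simp: perm_group_def BijGroup_def)

lemma perm_group_finite:
  assumes "perm_group \<Omega> G"
  shows "finite G" and "card G \<le> card \<Omega> ^ card \<Omega>"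
proof -
  have fin: "finite \<Omega>"
    using assms by (simp add: perm_group_def)
  then have finE: "finite (\<Omega> \<rightarrow>\<^sub>E \<Omega>)"
    by (simp add: finite_PiE)
  show "finite G"
    using finite_subset[OF perm_group_subset_PiE[OF assms] finE] .
  show "card G \<le> card \<Omega> ^ card \<Omega>"
    using card_mono[OF finE perm_group_subset_PiE[OF assms]] fin by (simp add: card_PiE)
qed

text \<open>The following facts show that all the maxima above are attained.\<close>

lemma finite_intersecting_cards:
  assumes "perm_group \<Omega> G"
  shows "finite {card F |F. F \<subseteq> G \<and> intersecting \<Omega> F}"
    and "{card F |F. F \<subseteq> G \<and> intersecting \<Omega> F} \<noteq> {}"
proof -
  have "{card F |F. F \<subseteq> G \<and> intersecting \<Omega> F} \<subseteq> card ` Pow G"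
    by blast
  then show "finite {card F |F. F \<subseteq> G \<and> intersecting \<Omega> F}"
    using perm_group_finite(1)[OF assms] by (meson finite_Pow_iff finite_imageI finite_subset)
  have "intersecting \<Omega> {}"
    by (simp add: intersecting_def)
  then show "{card F |F. F \<subseteq> G \<and> intersecting \<Omega> F} \<noteq> {}"
    by blast
qed

lemma finite_transitive_densities:
  assumes "n > 0"
  shows "finite (transitive_densities n)"
proof -
  let ?B = "{..n ^ n}"
  have "transitive_densities n \<subseteq> (\<lambda>(a, b). real a / real b) ` (?B \<times> ?B)"
  proof
    fix r assume "r \<in> transitive_densities n"
    then obtain \<Omega> :: "nat set" and G
      where r: "r = intersection_density \<Omega> G" and G: "perm_group \<Omega> G" and n: "card \<Omega> = n"
      by (auto simp: transitive_densities_def transitive_perm_group_def)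
    let ?X = "{card F |F. F \<subseteq> G \<and> intersecting \<Omega> F}"
    let ?Y = "{card (stabilizer (perm_monoid \<Omega> G) (\<lambda>g. g) \<omega>) |\<omega>. \<omega> \<in> \<Omega>}"
    have bound: "card F \<le> n ^ n" if "F \<subseteq> G" for F
      using card_mono[OF perm_group_finite(1)[OF G] that] perm_group_finite(2)[OF G] n by simp
    have "Max ?X \<in> ?X"
      using Max_in[OF finite_intersecting_cards[OF G]] .
    then have X: "Max ?X \<in> ?B"
      using bound by auto
    have "finite ?Y" "?Y \<noteq> {}"
      using G n assms by (auto simp: perm_group_def)
    then have "Max ?Y \<in> ?Y"
      by (rule Max_in)
    moreover have "stabilizer (perm_monoid \<Omega> G) (\<lambda>g. g) \<omega> \<subseteq> G" for \<omega>
      by (auto simp: stabilizer_def)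
    ultimately have Y: "Max ?Y \<in> ?B"
      using bound by auto
    show "r \<in> (\<lambda>(a, b). real a / real b) ` (?B \<times> ?B)"
      unfolding r intersection_density_def
      by (rule image_eqI[where x = "(Max ?X, Max ?Y)"]) (use X Y in simp_all)
  qed
  then show ?thesis
    by (rule finite_subset) simp
qed

lemma transitive_densities_nonempty: "transitive_densities n \<noteq> {}"
proof -
  let ?\<Omega> = "{..<n}" and ?G = "Bij {..<n}"
  have "perm_group ?\<Omega> ?G"
    using group.subgroup_self[OF group_BijGroup, of ?\<Omega>] by (simp add: perm_group_def BijGroup_def)
  moreover have "\<exists>g\<in>?G. g x = y" if "x \<in> ?\<Omega>" "y \<in> ?\<Omega>" for x y
  proof
    let ?t = "restrict (id(x := y, y := x)) ?\<Omega>"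
    have "bij_betw ?t ?\<Omega> ?\<Omega>"
      by (rule bij_betw_byWitness[where f' = ?t]) (use that in auto)
    then show "?t \<in> ?G"
      by (simp add: Bij_def)
    show "?t x = y"
      using that by auto
  qed
  ultimately have "transitive_perm_group ?\<Omega> ?G"
    by (simp add: transitive_perm_group_iff)
  moreover have "card ?\<Omega> = n"
    by simp
  ultimately show ?thesis
    unfolding transitive_densities_def by blast
qed

end

theory Submission
  imports Defs "HOL-Algebra.Multiplicative_Group" "HOL-Algebra.Sylow" "HOL-Number_Theory.Cong"
begin

text \<open>
  Upper bound: a Sylow \<open>p\<close>-subgroup \<open>P\<close> of a transitive group of degree \<open>2p\<close> has no fixed point, so
  all its orbits have size at least \<open>p\<close> and there are at most two of them. If every element of \<open>P\<close> had
  a fixed point, it would have at least \<open>p\<close> of them (their number is divisible by \<open>p\<close>), and Burnside's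
  lemma would give at least \<open>p > 2\<close> orbits. Hence some \<open>g\<close> of \<open>p\<close>-power order is a derangement;
  then \<open>1, g, \<dots>, g\<^bsup>p-1\<^esup>\<close> is a clique of the derangement graph, and the
  clique-coclique bound yields \<open>|F| p \<le> |G| = 2p |G\<^sub>\<omega>|\<close> for intersecting \<open>F\<close>.

  Lower bound: let \<open>C\<^sub>p\<close> permute \<open>p\<close> blocks of size two cyclically and let \<open>K\<close> consist of the
  products of an even number of block swaps. In the transitive group \<open>K C\<^sub>p\<close> the set \<open>K\<close> is
  intersecting, since the quotient of two of its elements cannot swap all \<open>p\<close> blocks, \<open>p\<close> being odd;
  and \<open>|K|\<close> is twice the order of a point stabilizer.
\<close>

section \<open>Orbits and fixed points of p-groups\<close>

lemma (in group_action) orbit_eqI: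
  assumes "x \<in> E" and "y \<in> orbit G \<phi> x"
  shows "orbit G \<phi> y = orbit G \<phi> x"
proof -
  have sub: "orbit G \<phi> z \<subseteq> E" if "z \<in> E" for z
    using that element_image by (auto simp: orbit_def)
  have "y \<in> E"
    using assms sub by blast
  then show ?thesis
    using assms sub orbit_trans orbit_sym by blast
qed

text \<open>By the orbit-stabilizer theorem the orbit size divides \<open>p ^ m\<close>, and it is
  not 1 because \<open>x\<close> and its image under \<open>g\<close> are two different points of
  the orbit.\<close>

lemma (in group_action) prime_dvd_card_orbit:
  assumes p: "prime (p::nat)" and ord: "order G = p ^ m" and x: "x \<in> E"
    and g: "g \<in> carrier G" "\<phi> g x \<noteq> x"
  shows "p dvd card (orbit G \<phi> x)"
proof -
  have "{x, \<phi> g x} \<subseteq> orbit G \<phi> x"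
    using orbit_refl[OF x] g(1) by (auto simp: orbit_def)
  then have ne1: "card (orbit G \<phi> x) \<noteq> 1"
    using g(2) by (metis card_1_singletonE insert_subset singletonD)
  have "card (orbit G \<phi> x) dvd p ^ m"
    using orbit_stabilizer_theorem[OF x] ord by (metis dvd_triv_left)
  then obtain i where "card (orbit G \<phi> x) = p ^ i"
    using p by (metis divides_primepow_nat)
  with ne1 show ?thesis
    by (cases i) auto
qed

text \<open>The moved points form a disjoint union of nontrivial orbits, and each of these has size
  divisible by \<open>p\<close>.\<close>

lemma (in group_action) prime_dvd_card_non_fixed:
  assumes p: "prime (p::nat)" and ord: "order G = p ^ m" and E: "finite E"
  shows "p dvd card {x \<in> E. \<exists>g\<in>carrier G. \<phi> g x \<noteq> x}"
proof -
  let ?N = "{x \<in> E. \<exists>g\<in>carrier G. \<phi> g x \<noteq> x}"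
  let ?C = "orbit G \<phi> ` ?N"
  have sub: "orbit G \<phi> z \<subseteq> E" if "z \<in> E" for z
    using that element_image by (auto simp: orbit_def)
  have finG: "finite (carrier G)"
    using ord p by (metis card.infinite order_def power_not_zero not_prime_0)
  have orb: "orbit G \<phi> x \<subseteq> ?N \<and> p dvd card (orbit G \<phi> x)" if xN: "x \<in> ?N" for x
  proof
    from xN have x: "x \<in> E" by simp
    obtain g where g: "g \<in> carrier G" "\<phi> g x \<noteq> x"
      using xN by blast
    then have two: "{x, \<phi> g x} \<subseteq> orbit G \<phi> x"
      using orbit_refl[OF x] by (auto simp: orbit_def)
    show "p dvd card (orbit G \<phi> x)"
      using prime_dvd_card_orbit[OF p ord x g] .
    show "orbit G \<phi> x \<subseteq> ?N"
    proof
      fix y assume y: "y \<in> orbit G \<phi> x"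
      then have "orbit G \<phi> y = orbit G \<phi> x"
        using orbit_eqI x by blast
      then have "{x, \<phi> g x} \<subseteq> orbit G \<phi> y"
        using two by simp
      then obtain z where "z \<in> orbit G \<phi> y" "z \<noteq> y"
        using g(2) by auto
      then show "y \<in> ?N"
        using y sub[OF x] by (auto simp: orbit_def)
    qed
  qed
  have union: "\<Union> ?C = ?N"
    using orb orbit_refl by blast
  have "card (\<Union> ?C) = sum card ?C"
  proof (rule card_Union_disjoint)
    show "pairwise disjnt ?C"
    proof (rule pairwiseI)
      fix A B assume "A \<in> ?C" "B \<in> ?C" "A \<noteq> B"
      then show "disjnt A B"
        unfolding disjnt_def using orbit_eqI by blast
    qed
    show "finite A" if "A \<in> ?C" for A
    proof -
      have "A \<subseteq> E"
        using that sub by auto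
      then show ?thesis
        using E by (rule finite_subset)
    qed
  qed
  moreover have "p dvd sum card ?C"
    by (rule dvd_sum) (use orb in auto)
  ultimately show ?thesis
    unfolding union by (simp only:)
qed

text \<open>Apply the preceding count to the cyclic subgroup generated by \<open>g\<close>: its
  order is again a power of \<open>p\<close>, and a point is fixed by all of it exactly when it is
  fixed by \<open>g\<close>, since stabilizers are subgroups.\<close>

lemma (in group_action) prime_dvd_card_non_invariants:
  assumes p: "prime (p::nat)" and ord: "order G = p ^ m" and E: "finite E" and g: "g \<in> carrier G"
  shows "p dvd card (E - invariants E \<phi> g)"
proof -
  interpret G: group G
    using group_hom group_hom.axioms(1) by blast
  let ?H = "generate G {g}"
  have H: "subgroup ?H G"
    using G.generate_is_subgroup g by blast
  interpret H: group_action "G\<lparr>carrier := ?H\<rparr>" E \<phi>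
    using induced_action[OF H] .
  have "card ?H dvd p ^ m"
    using G.lagrange[OF H] ord by (metis dvd_triv_right)
  then obtain k where "order (G\<lparr>carrier := ?H\<rparr>) = p ^ k"
    using p by (auto simp: order_def divides_primepow_nat)
  moreover have "{x \<in> E. \<exists>h\<in>carrier (G\<lparr>carrier := ?H\<rparr>). \<phi> h x \<noteq> x} = E - invariants E \<phi> g"
  proof -
    have "\<phi> h x = x" if "x \<in> E" "\<phi> g x = x" "h \<in> ?H" for x h
    proof -
      have "?H \<subseteq> stabilizer G \<phi> x"
        using that(1,2) g by (intro G.generate_subgroup_incl stabilizer_subgroup) (auto simp: stabilizer_def)
      then show ?thesis
        using that(3) by (auto simp: stabilizer_def)
    qed
    moreover have "g \<in> ?H"
      by (simp add: generate.incl)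
    ultimately show ?thesis
      by (auto simp: invariants_def)
  qed
  ultimately show ?thesis
    using H.prime_dvd_card_non_fixed[OF p _ E] by metis
qed

section \<open>A derangement of p-power order\<close>

lemma (in transitive_action) orbit_eq: "x \<in> E \<Longrightarrow> orbit G \<phi> x = E"
  using unique_orbit element_image by (fastforce simp: orbit_def)

text \<open>The exponent is a power of \<open>p\<close> rather than \<open>p\<close> because the
  action need not be faithful: when a cyclic group of order 2p^2 acts transitively on 2p points, all
  its elements of order p act trivially.\<close>

lemma (in transitive_action) exists_prime_power_order_derangement:
  assumes p: "prime (p::nat)" and odd: "odd p" and E: "card E = 2 * p"
    and fin: "finite (carrier G)"
  obtains g a where "g \<in> carrier G" "g [^]\<^bsub>G\<^esub> (p ^ a) = \<one>\<^bsub>G\<^esub>" "invariants E \<phi> g = {}"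
proof -
  interpret G: group G
    using group_hom group_hom.axioms(1) by blast
  have p3: "p \<ge> 3"
    using p odd prime_ge_2_nat[of p] by (cases "p = 2") auto
  have finE: "finite E"
    using E p3 card.infinite by fastforce
  have G0: "order G > 0"
    using fin G.order_gt_0_iff_finite by blast
  define a where "a = multiplicity p (order G)"
  obtain m where m: "order G = p ^ a * m"
    using multiplicity_dvd[of p "order G"] by (auto simp: a_def)
  obtain P where P: "subgroup P G" "card P = p ^ a"
    using sylow_thm[OF p G.is_group m fin] by blast
  interpret P: group_action "G\<lparr>carrier := P\<rparr>" E \<phi>
    using induced_action[OF P(1)] .
  interpret PG: group "G\<lparr>carrier := P\<rparr>"
    using P.group_hom group_hom.axioms(1) by blast
  have ordP: "order (G\<lparr>carrier := P\<rparr>) = p ^ a"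
    using P(2) by (simp add: order_def)
  have finP: "finite (carrier (G\<lparr>carrier := P\<rparr>))"
    using P(1) fin using finite_subset[OF subgroup.subset] by fastforce
  \<comment> \<open>If \<open>P\<close> fixed \<open>x\<close>, then \<open>p ^ a\<close> would
    divide the order of the stabilizer of \<open>x\<close>. The group order is \<open>2 * p\<close>
    times that order, so it would be divisible by \<open>p ^ Suc a\<close>, against the choice of
    \<open>a\<close>.\<close>
  have moved: "\<exists>g\<in>P. \<phi> g x \<noteq> x" if x: "x \<in> E" for x
  proof (rule ccontr)
    assume "\<not> ?thesis"
    then have "P \<subseteq> stabilizer G \<phi> x"
      using P(1) subgroup.subset by (fastforce simp: stabilizer_def)
    then have "subgroup P (G\<lparr>carrier := stabilizer G \<phi> x\<rparr>)"
      using G.subgroup_incl P(1) stabilizer_subgroup[OF x] by blast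
    then have "card P dvd card (stabilizer G \<phi> x)"
      using group.lagrange[OF G.subgroup_imp_group[OF stabilizer_subgroup[OF x]], of P]
      by (simp add: order_def) (metis dvd_triv_right)
    then have "2 * p * p ^ a dvd order G"
      unfolding orbit_stabilizer_theorem[OF x, symmetric] orbit_eq[OF x] E P(2)
      by (rule mult_dvd_mono[OF dvd_refl])
    then have "p ^ Suc a dvd order G"
      by (intro dvd_mult_left[of "p ^ Suc a" 2]) (simp add: ac_simps)
    then have "Suc a \<le> multiplicity p (order G)"
      using G0 p by (intro multiplicity_geI) auto
    then show False
      by (simp add: a_def)
  qed
  let ?O = "orbits (G\<lparr>carrier := P\<rparr>) E \<phi>"
  have orb: "p \<le> card B" if B: "B \<in> ?O" for B
  proof -
    obtain x where x: "x \<in> E" "B = orbit (G\<lparr>carrier := P\<rparr>) \<phi> x"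
      using B by (auto simp: orbits_def)
    have "p dvd card B"
      using P.prime_dvd_card_orbit[OF p ordP x(1)] moved[OF x(1)] x(2) by auto
    moreover have "finite B"
      using x(2) finP by (simp add: orbit_def)
    then have "card B > 0"
      using P.orbit_refl[OF x(1)] x(2) card_gt_0_iff by blast
    ultimately show ?thesis
      by (rule dvd_imp_le)
  qed
  have "sum card ?O = card E"
    using partition.disjoint_sum[OF P.orbit_partition finE, of "\<lambda>_. 1 :: nat"] by simp
  then have "card ?O * p \<le> card E"
    using sum_bounded_below[of ?O p card] orb by simp
  then have "card (orbits (G\<lparr>carrier := P\<rparr>) E \<phi>) \<le> 2"
    using E p3 by simp
  then have le: "(\<Sum>g\<in>P. card (invariants E \<phi> g)) \<le> 2 * p ^ a"
    using P.burnside[OF finP finE] mult_le_mono1[of "card ?O" 2 "p ^ a"] ordP by simp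
  have "\<exists>g\<in>P. invariants E \<phi> g = {}"
  proof (rule ccontr)
    assume ne: "\<not> ?thesis"
    have "p \<le> card (invariants E \<phi> g)" if "g \<in> P" for g
    proof -
      have sub: "invariants E \<phi> g \<subseteq> E"
        by (auto simp: invariants_def)
      \<comment> \<open>The number of moved points and \<open>card E = 2 * p\<close> are both
        divisible by \<open>p\<close>, hence so is the number of fixed points.\<close>
      have "p dvd card E - card (invariants E \<phi> g)"
        using P.prime_dvd_card_non_invariants[OF p ordP finE, of g] that sub finE
        by (simp add: card_Diff_subset finite_subset)
      then have "p dvd card (invariants E \<phi> g)"
        using E sub finE by (metis card_mono dvd_diffD1 dvd_triv_right)
      moreover have "card (invariants E \<phi> g) > 0"
        using ne that sub finE by (meson card_gt_0_iff finite_subset)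
      ultimately show ?thesis
        by (rule dvd_imp_le)
    qed
    then have "card P * p \<le> (\<Sum>g\<in>P. card (invariants E \<phi> g))"
      using sum_bounded_below[of P p "\<lambda>g. card (invariants E \<phi> g)"] by simp
    \<comment> \<open>Oddness of \<open>p\<close> enters here, through \<open>p \<ge> 3\<close>: at
      least \<open>p\<close> fixed points on average are too many for two orbits.\<close>
    with le have "p ^ a * p \<le> p ^ a * 2"
      unfolding P(2) by linarith
    then show False
      using p3 by simp
  qed
  then obtain g where g: "g \<in> P" "invariants E \<phi> g = {}"
    by blast
  moreover have "g \<in> carrier G"
    using g P(1) subgroup.subset by blast
  moreover have "g [^]\<^bsub>G\<^esub> (p ^ a) = \<one>\<^bsub>G\<^esub>"
    using PG.pow_order_eq_1[of g] g ordP by (simp add: nat_pow_def)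
  ultimately show thesis
    using that by blast
qed

section \<open>The clique-coclique bound\<close>

text \<open>The map sending \<open>(f, s)\<close> to \<open>f \<otimes> inv s\<close> is injective.
  Given equal values at \<open>(f, s)\<close> and \<open>(f', s')\<close>, take \<open>x\<close> on
  which \<open>f\<close> and \<open>f'\<close> agree and evaluate at the image of \<open>x\<close>
  under \<open>s\<close>. Cancelling \<open>f'\<close> shows that \<open>s\<close> and
  \<open>s'\<close> agree at \<open>x\<close>, so they are equal, and then so are \<open>f\<close>
  and \<open>f'\<close>.\<close>

lemma (in group_action) clique_coclique_bound:
  assumes fin: "finite (carrier G)" and F: "F \<subseteq> carrier G" and S: "S \<subseteq> carrier G"
    and int: "\<And>f f'. f \<in> F \<Longrightarrow> f' \<in> F \<Longrightarrow> \<exists>x\<in>E. \<phi> f x = \<phi> f' x"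
    and der: "\<And>s s' x. s \<in> S \<Longrightarrow> s' \<in> S \<Longrightarrow> x \<in> E \<Longrightarrow> \<phi> s x = \<phi> s' x \<Longrightarrow> s = s'"
  shows "card F * card S \<le> order G"
proof -
  interpret G: group G
    using group_hom group_hom.axioms(1) by blast
  let ?h = "\<lambda>(f, s). f \<otimes> inv s"
  have "inj_on ?h (F \<times> S)"
  proof (rule inj_onI, clarify)
    fix f s f' s'
    assume in_sets: "f \<in> F" "s \<in> S" "f' \<in> F" "s' \<in> S" and eq: "f \<otimes> inv s = f' \<otimes> inv s'"
    then have car: "f \<in> carrier G" "s \<in> carrier G" "f' \<in> carrier G" "s' \<in> carrier G"
      using F S by auto
    obtain x where x: "x \<in> E" "\<phi> f x = \<phi> f' x"
      using int in_sets by blast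
    have y: "\<phi> s x \<in> E"
      using car x element_image by blast
    have "\<phi> (inv s) (\<phi> s x) = x"
      using orbit_sym_aux car x by blast
    then have "\<phi> (f \<otimes> inv s) (\<phi> s x) = \<phi> f' x"
      using composition_rule[OF y] car x by simp
    moreover have "\<phi> (f' \<otimes> inv s') (\<phi> s x) = \<phi> f' (\<phi> (inv s') (\<phi> s x))"
      using composition_rule[OF y] car by simp
    ultimately have "\<phi> (inv s') (\<phi> s x) = x"
      using eq inj_prop[OF car(3)] x(1) y car element_image[OF G.inv_closed[OF car(4)] y refl] by (auto dest: inj_onD)
    then have "\<phi> s' x = \<phi> s x"
      using orbit_sym_aux[OF G.inv_closed[OF car(4)] y] car by simp
    then have "s = s'"
      using der in_sets x(1) by metis
    then show "f = f' \<and> s = s'"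
      using eq car by simp
  qed
  moreover have "?h ` (F \<times> S) \<subseteq> carrier G"
    using F S by auto
  ultimately have "card (F \<times> S) \<le> card (carrier G)"
    using fin card_inj_on_le by blast
  then show ?thesis
    by (simp add: card_cartesian_product order_def)
qed

lemma (in transitive_action) prime_card_mult_intersecting_le:
  assumes p: "prime (p::nat)" and odd: "odd p" and E: "card E = 2 * p"
    and fin: "finite (carrier G)" and F: "F \<subseteq> carrier G"
    and int: "\<And>f f'. f \<in> F \<Longrightarrow> f' \<in> F \<Longrightarrow> \<exists>x\<in>E. \<phi> f x = \<phi> f' x"
  shows "card F * p \<le> order G"
proof -
  interpret G: group G
    using group_hom group_hom.axioms(1) by blast
  obtain g a where g: "g \<in> carrier G" "g [^] (p ^ a) = \<one>" "invariants E \<phi> g = {}"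
    using exists_prime_power_order_derangement[OF p odd E fin] by blast
  have fixfree: "\<phi> (g [^] k) x \<noteq> x" if k: "0 < k" "k < p" and x: "x \<in> E" for k x
  proof
    assume "\<phi> (g [^] k) x = x"
    then have stab: "g [^] k \<in> stabilizer G \<phi> x"
      using g(1) by (simp add: stabilizer_def)
    \<comment> \<open>By Bezout \<open>g\<close> is itself a power of \<open>g [^] k\<close>, so a
      fixed point of \<open>g [^] k\<close> would be fixed by \<open>g\<close>.\<close>
    have "coprime k (p ^ a)"
      using k p by (metis coprime_commute coprime_power_right_iff nat_dvd_not_less prime_imp_coprime)
    then obtain u v where "k * u = p ^ a * v + 1"
      using k bezout_nat[of k "p ^ a"] by (auto simp: coprime_iff_gcd_eq_1)
    then have "(g [^] k) [^] u = (g [^] (p ^ a)) [^] v \<otimes> g"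
      using g(1) by (simp add: G.nat_pow_pow)
    also have "\<dots> = g"
      using g(1,2) by simp
    finally have "g \<in> stabilizer G \<phi> x"
      using G.subgroup_int_pow_closed[OF stabilizer_subgroup[OF x] stab, of "int u"] by (simp add: int_pow_int)
    then show False
      using g(3) x by (auto simp: stabilizer_def invariants_def)
  qed
  have less: "\<phi> (g [^] i) x \<noteq> \<phi> (g [^] j) x" if "i < j" "j < p" "x \<in> E" for i j x
  proof
    assume eq: "\<phi> (g [^] i) x = \<phi> (g [^] j) x"
    have y: "\<phi> (g [^] (j - i)) x \<in> E"
      using element_image g(1) that(3) by blast
    have "g [^] j = g [^] i \<otimes> g [^] (j - i)"
      using that g(1) by (simp add: G.nat_pow_mult)
    then have "\<phi> (g [^] i) (\<phi> (g [^] (j - i)) x) = \<phi> (g [^] i) x"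
      using composition_rule that(3) g(1) eq by simp
    then have "\<phi> (g [^] (j - i)) x = x"
      using inj_onD[OF inj_prop[of "g [^] i"] _ y that(3)] g(1) by simp
    then show False
      using fixfree[of "j - i" x] that by simp
  qed
  then have ne: "\<phi> (g [^] i) x \<noteq> \<phi> (g [^] j) x" if "i \<noteq> j" "i < p" "j < p" "x \<in> E" for i j x
    using that by (metis linorder_neqE_nat)
  let ?S = "(\<lambda>i::nat. g [^] i) ` {..<p}"
  \<comment> \<open>A point is needed to tell the powers apart: they are known to be distinct only
    through their values.\<close>
  have "E \<noteq> {}"
    using E p by (auto dest: prime_gt_0_nat)
  then have "inj_on (\<lambda>i::nat. g [^] i) {..<p}"
    using ne by (intro inj_onI) (metis all_not_in_conv lessThan_iff)
  then have "card ?S = p"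
    by (simp add: card_image)
  moreover have "card F * card ?S \<le> order G"
  proof (rule clique_coclique_bound[OF fin F _ int])
    show "?S \<subseteq> carrier G"
      using g(1) by auto
    show "s = s'" if "s \<in> ?S" "s' \<in> ?S" "x \<in> E" "\<phi> s x = \<phi> s' x" for s s' x
    proof -
      obtain i j where "s = g [^] i" "s' = g [^] j" "i < p" "j < p"
        using \<open>s \<in> ?S\<close> \<open>s' \<in> ?S\<close> by auto
      then show ?thesis
        using ne[of i j x] that(3,4) by (cases "i = j") auto
    qed
  qed
  ultimately show ?thesis
    by simp
qed

section \<open>The upper bound on the density\<close>

text \<open>Under transitivity all point stabilizers have the same order, so the maximum in the
  denominator runs over a singleton. The resulting quotient has the group order as its denominator,
  which suits both bounds.\<close>

lemma intersection_density_transitive: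
  assumes G: "transitive_perm_group \<Omega> G" and ne: "\<Omega> \<noteq> {}"
  shows "intersection_density \<Omega> G =
    real (card \<Omega> * Max {card F |F. F \<subseteq> G \<and> intersecting \<Omega> F}) / real (card G)"
proof -
  interpret transitive_action "perm_monoid \<Omega> G" \<Omega> "\<lambda>g. g"
    using G by (simp add: transitive_perm_group_def)
  let ?st = "stabilizer (perm_monoid \<Omega> G) (\<lambda>g. g)"
  have pg: "perm_group \<Omega> G"
    using G by (simp add: transitive_perm_group_def)
  then have pos: "card \<Omega> > 0"
    using ne by (simp add: perm_group_def card_gt_0_iff)
  have st: "card \<Omega> * card (?st \<omega>) = card G" if "\<omega> \<in> \<Omega>" for \<omega>
    using orbit_stabilizer_theorem[OF that] orbit_eq[OF that] by (simp add: order_def)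
  then have "card (?st \<omega>) = card G div card \<Omega>" if "\<omega> \<in> \<Omega>" for \<omega>
    using that pos by (metis nonzero_mult_div_cancel_left less_not_refl)
  then have "(\<lambda>\<omega>. card (?st \<omega>)) ` \<Omega> = {card G div card \<Omega>}"
    using ne by auto
  then have "{card (?st \<omega>) |\<omega>. \<omega> \<in> \<Omega>} = {card G div card \<Omega>}"
    by (simp add: Setcompr_eq_image)
  then have "intersection_density \<Omega> G =
    real (Max {card F |F. F \<subseteq> G \<and> intersecting \<Omega> F}) / real (card G div card \<Omega>)"
    unfolding intersection_density_def by simp
  moreover have "card \<Omega> dvd card G"
    using st ne by (metis all_not_in_conv dvd_triv_left)
  ultimately show ?thesis
    using pos by (simp add: real_of_nat_div)
qed

lemma intersection_density_le_2:
  assumes p: "prime p" "odd p" and G: "transitive_perm_group \<Omega> G" and n: "card \<Omega> = 2 * p"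
  shows "intersection_density \<Omega> G \<le> 2"
proof -
  let ?X = "{card F |F. F \<subseteq> G \<and> intersecting \<Omega> F}"
  interpret transitive_action "perm_monoid \<Omega> G" \<Omega> "\<lambda>g. g"
    using G by (simp add: transitive_perm_group_def)
  have pg: "perm_group \<Omega> G"
    using G by (simp add: transitive_perm_group_def)
  have "Max ?X \<in> ?X"
    using Max_in[OF finite_intersecting_cards[OF pg]] .
  then obtain F where F: "F \<subseteq> G" "intersecting \<Omega> F" "Max ?X = card F"
    by blast
  have "card F * p \<le> card G"
    using prime_card_mult_intersecting_le[OF p n, of F] F perm_group_finite(1)[OF pg]
    by (simp add: order_def intersecting_def intersecting_perms_def)
  then have "card \<Omega> * Max ?X \<le> 2 * card G"
    using n F(3) by (simp add: mult.commute)
  then have "real (card \<Omega> * Max ?X) \<le> real (2 * card G)"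
    by (rule of_nat_mono)
  moreover have "card G > 0"
    using perm_group_imp_group[OF pg] perm_group_finite(1)[OF pg] monoid.order_gt_0_iff_finite[OF group.is_monoid, of "perm_monoid \<Omega> G"]
    by (simp add: order_def)
  moreover have "\<Omega> \<noteq> {}"
    using n p by (auto dest: prime_gt_0_nat)
  ultimately show ?thesis
    using intersection_density_transitive[OF G] by (simp add: divide_le_eq)
qed

section \<open>A transitive group of degree 2p with a large intersecting set\<close>

text \<open>
  The points are the residues modulo \<open>2p\<close>, with blocks \<open>{n, n + p}\<close>, so that adding \<open>p\<close> swaps a
  block. As \<open>p\<close> is odd, adding an even \<open>t\<close> is an element of the subgroup of order \<open>p\<close> of the
  translations. Only the parities of the values \<open>c i\<close> for \<open>i < p\<close> matter.
\<close>

definition shift_swap :: "nat \<Rightarrow> nat \<Rightarrow> (nat \<Rightarrow> nat) \<Rightarrow> nat \<Rightarrow> nat" where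
  "shift_swap p t c = (\<lambda>n\<in>{..<2 * p}. (n + t + p * c (n mod p)) mod (2 * p))"

text \<open>This is the group \<open>K C_p\<close> of the overview, and \<open>even_swaps\<close> is
  its subset \<open>K\<close>. The sum of the \<open>c i\<close> has the parity of the number of
  swapped blocks.\<close>

definition even_shift_swaps :: "nat \<Rightarrow> (nat \<Rightarrow> nat) set" where
  "even_shift_swaps p = {shift_swap p t c |t c. even t \<and> even (\<Sum>i<p. c i)}"

definition even_swaps :: "nat \<Rightarrow> (nat \<Rightarrow> nat) set" where
  "even_swaps p = {shift_swap p 0 c |c. even (\<Sum>i<p. c i)}"

lemma even_shift_swapsI:
  "even t \<Longrightarrow> even (\<Sum>i<p. c i) \<Longrightarrow> shift_swap p t c \<in> even_shift_swaps p"
  by (auto simp: even_shift_swaps_def)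

lemma shift_swap_in: "p > 0 \<Longrightarrow> shift_swap p t c \<in> {..<2 * p} \<rightarrow> {..<2 * p}"
  by (auto simp: shift_swap_def)

text \<open>The inner map sends block \<open>i\<close> to block \<open>(i + t) mod p\<close>, so the
  outer one reads \<open>d\<close> at the shifted index.\<close>

lemma shift_swap_compose:
  assumes "p > 0"
  shows "compose {..<2 * p} (shift_swap p u d) (shift_swap p t c) =
    shift_swap p (t + u) (\<lambda>i. c i + d ((i + t) mod p))"
proof
  fix n
  show "compose {..<2 * p} (shift_swap p u d) (shift_swap p t c) n =
    shift_swap p (t + u) (\<lambda>i. c i + d ((i + t) mod p)) n"
  proof (cases "n < 2 * p")
    case True
    let ?m = "(n + t + p * c (n mod p)) mod (2 * p)"
    have m: "?m mod p = (n mod p + t) mod p"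
      by (simp add: mod_mod_cancel mod_simps)
    have "compose {..<2 * p} (shift_swap p u d) (shift_swap p t c) n =
      (?m + u + p * d (?m mod p)) mod (2 * p)"
      using True assms by (simp add: compose_def shift_swap_def)
    also have "\<dots> = (n + t + p * c (n mod p) + (u + p * d ((n mod p + t) mod p))) mod (2 * p)"
      unfolding m by (simp only: add.assoc mod_add_left_eq)
    also have "\<dots> = shift_swap p (t + u) (\<lambda>i. c i + d ((i + t) mod p)) n"
      using True by (simp add: shift_swap_def distrib_left ac_simps)
    finally show ?thesis .
  qed (simp add: compose_def shift_swap_def)
qed

text \<open>Modulo \<open>2 * p\<close>, the term \<open>p * c i\<close> depends only on the parity
  of \<open>c i\<close>. Parameters are thus far from unique, and this lemma identifies elements
  given by different ones.\<close>

lemma shift_swap_cong: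
  assumes "[t = t'] (mod 2 * p)" "\<And>i. i < p \<Longrightarrow> [c i = c' i] (mod 2)"
  shows "shift_swap p t c = shift_swap p t' c'"
proof
  fix n
  show "shift_swap p t c n = shift_swap p t' c' n"
  proof (cases "n < 2 * p")
    case True
    then have "[p * c (n mod p) = p * c' (n mod p)] (mod p * 2)"
      using assms(2)[of "n mod p"] by (simp add: cong_def flip: mult_mod_right)
    then have "[n + t + p * c (n mod p) = n + t' + p * c' (n mod p)] (mod 2 * p)"
      using assms(1) by (intro cong_add) (simp_all add: mult.commute)
    then show ?thesis
      using True by (simp add: shift_swap_def cong_def)
  qed (simp add: shift_swap_def)
qed

text \<open>This keeps the parity of the number of swaps under control when composition shifts the
  block indices.\<close>

lemma sum_shift_mod:
  fixes p t :: nat and c :: "nat \<Rightarrow> nat"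
  assumes "p > 0"
  shows "(\<Sum>i<p. c ((i + t) mod p)) = (\<Sum>i<p. c i)"
proof (rule sum.reindex_bij_betw)
  show "bij_betw (\<lambda>i. (i + t) mod p) {..<p} {..<p}"
  \<comment> \<open>Adding \<open>(p - 1) * t\<close> is subtracting \<open>t\<close> modulo
    \<open>p\<close>, without truncated subtraction.\<close>
  proof (rule bij_betw_byWitness[where f' = "\<lambda>i. (i + (p - 1) * t) mod p"])
    have "t + (p - 1) * t = p * t"
      using assms by (cases p) auto
    then have eq: "i + t + (p - 1) * t = i + p * t" "i + (p - 1) * t + t = i + p * t" for i
      by auto
    have "(i + t + (p - 1) * t) mod p = i" "(i + (p - 1) * t + t) mod p = i" if "i < p" for i
      unfolding eq using that by simp_all
    then show "\<forall>i\<in>{..<p}. ((i + t) mod p + (p - 1) * t) mod p = i"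
      "\<forall>i\<in>{..<p}. ((i + (p - 1) * t) mod p + t) mod p = i"
      by (simp_all add: mod_simps)
  qed (use assms in auto)
qed

lemma even_shift_swaps_compose:
  assumes "p > 0" "f \<in> even_shift_swaps p" "g \<in> even_shift_swaps p"
  shows "compose {..<2 * p} f g \<in> even_shift_swaps p"
proof -
  obtain t c u d where f: "f = shift_swap p u d" "even u" "even (\<Sum>i<p. d i)"
    and g: "g = shift_swap p t c" "even t" "even (\<Sum>i<p. c i)"
    using assms by (auto simp: even_shift_swaps_def)
  have "even (\<Sum>i<p. c i + d ((i + t) mod p))"
    using f(3) g(3) by (simp add: sum.distrib sum_shift_mod[OF assms(1)])
  then show ?thesis
    using f g shift_swap_compose[OF assms(1)] unfolding even_shift_swaps_def by (metis (mono_tags, lifting) even_add mem_Collect_eq)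
qed

text \<open>Left inverses suffice: they give injectivity, hence bijectivity on the finite set of
  points, and then they are the inverses in \<open>BijGroup\<close>.\<close>

lemma even_shift_swaps_left_inverse:
  assumes p: "p > 0" and f: "f \<in> even_shift_swaps p"
  obtains g where "g \<in> even_shift_swaps p" "compose {..<2 * p} g f = (\<lambda>x\<in>{..<2 * p}. x)"
proof -
  obtain t c where f: "f = shift_swap p t c" "even t" "even (\<Sum>i<p. c i)"
    using f by (auto simp: even_shift_swaps_def)
  \<comment> \<open>\<open>?u\<close> is an even representative of \<open>-t\<close> modulo
    \<open>2 * p\<close>. The index shift in \<open>?d\<close> undoes the one caused by composition,
    so that every \<open>c i\<close> is added twice and disappears modulo 2.\<close>
  let ?u = "(2 * p - 1) * t" and ?d = "\<lambda>i. c ((i + (2 * p - 1) * t) mod p)"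
  have tu: "t + ?u = 2 * p * t"
    using p by (cases p) auto
  have "shift_swap p ?u ?d \<in> even_shift_swaps p"
    using f(2,3) by (intro even_shift_swapsI) (simp_all add: sum_shift_mod[OF p])
  moreover have "compose {..<2 * p} (shift_swap p ?u ?d) f = shift_swap p 0 (\<lambda>_. 0)"
    unfolding f(1) shift_swap_compose[OF p]
  proof (rule shift_swap_cong)
    show "[t + ?u = 0] (mod 2 * p)"
      unfolding tu by (simp add: cong_def)
    fix i assume "i < p"
    have "((i + t) mod p + ?u) mod p = (i + (t + ?u)) mod p"
      by (simp add: mod_simps add.assoc)
    also have "\<dots> = i"
      unfolding tu using \<open>i < p\<close> by (simp add: mult.commute mult.left_commute)
    finally show "[c i + ?d ((i + t) mod p) = 0] (mod 2)"
      by (simp add: cong_def)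
  qed
  moreover have "shift_swap p 0 (\<lambda>_. 0) = (\<lambda>x\<in>{..<2 * p}. x)"
    by (auto simp: shift_swap_def)
  ultimately show thesis
    using that by simp
qed

lemma even_shift_swaps_subset_Bij:
  assumes p: "p > 0"
  shows "even_shift_swaps p \<subseteq> Bij {..<2 * p}"
proof
  fix f assume f: "f \<in> even_shift_swaps p"
  obtain g where g: "compose {..<2 * p} g f = (\<lambda>x\<in>{..<2 * p}. x)"
    using even_shift_swaps_left_inverse[OF p f] by blast
  have "inj_on f {..<2 * p}"
    by (rule inj_on_inverseI[where g = g]) (use g in \<open>metis compose_eq restrict_apply'\<close>)
  moreover have "f \<in> {..<2 * p} \<rightarrow> {..<2 * p}" "f \<in> extensional {..<2 * p}"
    using f shift_swap_in[OF p] by (auto simp: even_shift_swaps_def shift_swap_def)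
  ultimately show "f \<in> Bij {..<2 * p}"
    using endo_inj_surj[of "{..<2 * p}" f] by (auto simp: Bij_def bij_betw_def)
qed

lemma perm_group_even_shift_swaps:
  assumes p: "p > 0"
  shows "perm_group {..<2 * p} (even_shift_swaps p)"
proof -
  interpret B: group "BijGroup {..<2 * p}"
    by (rule group_BijGroup)
  note sub = even_shift_swaps_subset_Bij[OF p]
  have "subgroup (even_shift_swaps p) (BijGroup {..<2 * p})"
  proof (rule B.subgroupI)
    show "even_shift_swaps p \<subseteq> carrier (BijGroup {..<2 * p})"
      using sub by (simp add: BijGroup_def)
    show "even_shift_swaps p \<noteq> {}"
      using even_shift_swapsI[of 0 "\<lambda>_. 0"] by auto
    show "f \<otimes>\<^bsub>BijGroup {..<2 * p}\<^esub> g \<in> even_shift_swaps p"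
      if "f \<in> even_shift_swaps p" "g \<in> even_shift_swaps p" for f g
      using that sub even_shift_swaps_compose[OF p that] by (auto simp: BijGroup_def)
    show "inv\<^bsub>BijGroup {..<2 * p}\<^esub> f \<in> even_shift_swaps p" if f: "f \<in> even_shift_swaps p" for f
    proof -
      obtain g where g: "g \<in> even_shift_swaps p" "compose {..<2 * p} g f = (\<lambda>x\<in>{..<2 * p}. x)"
        using even_shift_swaps_left_inverse[OF p f] by blast
      then have "inv\<^bsub>BijGroup {..<2 * p}\<^esub> f = g"
        using f sub by (intro B.inv_equality) (auto simp: BijGroup_def)
      then show ?thesis
        using g by simp
    qed
  qed
  then show ?thesis
    by (simp add: perm_group_def)
qed

lemma transitive_even_shift_swaps:
  assumes p: "odd p" "p > 1"
  shows "transitive_perm_group {..<2 * p} (even_shift_swaps p)"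
  unfolding transitive_perm_group_iff
proof (intro conjI ballI)
  show "perm_group {..<2 * p} (even_shift_swaps p)"
    using perm_group_even_shift_swaps p by simp
  fix x y assume x: "x \<in> {..<2 * p}" and y: "y \<in> {..<2 * p}"
  \<comment> \<open>The displacement from \<open>x\<close> to \<open>y\<close> is raised by
    \<open>2 * p\<close> to avoid truncation; this changes neither its parity nor its
    residue.\<close>
  have *: "x + (y + 2 * p - x) = y + 2 * p"
    using x by simp
  show "\<exists>g\<in>even_shift_swaps p. g x = y"
  proof (cases "even (y + 2 * p - x)")
    case True
    then have "shift_swap p (y + 2 * p - x) (\<lambda>_. 0) \<in> even_shift_swaps p"
      by (intro even_shift_swapsI) auto
    moreover have "shift_swap p (y + 2 * p - x) (\<lambda>_. 0) x = y"
      using x y * by (simp add: shift_swap_def)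
    ultimately show ?thesis
      by blast
  next
    case False
    \<comment> \<open>For an odd displacement, \<open>p\<close> is added to make it even, and the
      swap at the block of \<open>x\<close> adds another \<open>p\<close>, for a total of
      \<open>2 * p\<close>. To keep the number of swaps even, all blocks are swapped except block
      \<open>k\<close>, chosen different from the block of \<open>x\<close>; this leaves
      \<open>p - 1\<close> swaps.\<close>
    define k where "k = (if x mod p = 0 then 1 else 0 :: nat)"
    let ?c = "\<lambda>i. if i = k then 0 else 1 :: nat"
    have "k < p"
      using p by (simp add: k_def)
    then have "(\<Sum>i<p. ?c i) = p - 1"
      by (simp add: sum.If_cases flip: Diff_eq)
    then have "shift_swap p (y + 2 * p - x + p) ?c \<in> even_shift_swaps p"
      using p False by (intro even_shift_swapsI) simp_all
    moreover have "shift_swap p (y + 2 * p - x + p) ?c x = y"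
    proof -
      have "x mod p \<noteq> k"
        by (simp add: k_def)
      moreover have "x + (y + 2 * p - x + p) + p = y + 2 * p * 2"
        using * by simp
      moreover have "(y + 2 * p * 2) mod (2 * p) = y"
        unfolding mod_mult_self2 using y by simp
      ultimately show ?thesis
        using x by (simp add: shift_swap_def add.commute[of y])
    qed
    ultimately show ?thesis
      by blast
  qed
qed

lemma intersecting_even_swaps:
  assumes "odd p"
  shows "intersecting {..<2 * p} (even_swaps p)"
  unfolding intersecting_def intersecting_perms_def
proof (intro ballI)
  fix f g assume "f \<in> even_swaps p" "g \<in> even_swaps p"
  then obtain c d where f: "f = shift_swap p 0 c" "even (\<Sum>i<p. c i)"
    and g: "g = shift_swap p 0 d" "even (\<Sum>i<p. d i)"
    by (auto simp: even_swaps_def)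
  \<comment> \<open>At such an \<open>i\<close> both maps treat block \<open>i\<close> alike.
    Otherwise \<open>p\<close> odd numbers, with \<open>p\<close> odd, would add up to the even
    total of the two sums.\<close>
  have "\<exists>i<p. even (c i + d i)"
  proof (rule ccontr)
    assume "\<not> ?thesis"
    then have "{i \<in> {..<p}. odd (c i + d i)} = {..<p}"
      by auto
    then have "odd (\<Sum>i<p. c i + d i)"
      using assms by (simp add: even_sum_iff)
    then show False
      using f g by (simp add: sum.distrib)
  qed
  then obtain i where i: "i < p" "even (c i + d i)"
    by blast
  then have "[c i = d i] (mod 2)"
    by (simp add: cong_def mod2_eq_if)
  then have "[p * c i = p * d i] (mod 2 * p)"
    by (simp add: cong_def mult.commute[of 2] flip: mult_mod_right)
  then have "[i + p * c i = i + p * d i] (mod 2 * p)"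
    by (intro cong_add) auto
  then have "f i = g i"
    using i f g by (simp add: shift_swap_def cong_def)
  then show "\<exists>\<omega>\<in>{..<2 * p}. f \<omega> = g \<omega>"
    using i by auto
qed

text \<open>Every element is an element of \<open>K\<close> followed by one of the \<open>p\<close>
  translations by \<open>2 * s\<close> with \<open>s < p\<close>. The inequality bounds
  \<open>K\<close> from below relative to the group, so neither set has to be counted.\<close>

lemma card_even_shift_swaps_le:
  assumes p: "p > 0"
  shows "card (even_shift_swaps p) \<le> p * card (even_swaps p)"
proof -
  have sub: "even_swaps p \<subseteq> even_shift_swaps p"
    by (auto simp: even_swaps_def even_shift_swaps_def)
  have fin: "finite (even_swaps p)"
    using finite_subset[OF sub] perm_group_finite(1)[OF perm_group_even_shift_swaps[OF p]] .
  let ?h = "\<lambda>(s, f). compose {..<2 * p} (shift_swap p (2 * s) (\<lambda>_. 0)) f"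
  have "even_shift_swaps p \<subseteq> ?h ` ({..<p} \<times> even_swaps p)"
  proof
    fix f assume "f \<in> even_shift_swaps p"
    then obtain t c where f: "f = shift_swap p t c" "even t" "even (\<Sum>i<p. c i)"
      by (auto simp: even_shift_swaps_def)
    then obtain u where u: "t = 2 * u"
      by blast
    have "[t = 2 * (u mod p)] (mod 2 * p)"
      unfolding u by (simp add: cong_def flip: mult_mod_right)
    then have "f = ?h (u mod p, shift_swap p 0 c)"
      unfolding f(1) prod.case shift_swap_compose[OF p] by (intro shift_swap_cong) auto
    then show "f \<in> ?h ` ({..<p} \<times> even_swaps p)"
      using f(3) p by (intro image_eqI[where x = "(u mod p, shift_swap p 0 c)"]) (auto simp: even_swaps_def)
  qed
  then have "card (even_shift_swaps p) \<le> card ({..<p} \<times> even_swaps p)"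
    using fin by (intro surj_card_le) auto
  then show ?thesis
    by (simp add: card_cartesian_product)
qed

section \<open>The density of the example and the value of I(2p)\<close>

lemma intersection_density_even_shift_swaps:
  assumes p: "prime p" "odd p"
  shows "intersection_density {..<2 * p} (even_shift_swaps p) = 2"
proof (rule antisym)
  let ?G = "even_shift_swaps p"
  let ?X = "{card F |F. F \<subseteq> ?G \<and> intersecting {..<2 * p} F}"
  have p1: "p > 1"
    using p(1) by (rule prime_gt_1_nat)
  have tr: "transitive_perm_group {..<2 * p} ?G"
    using transitive_even_shift_swaps p(2) p1 .
  have pg: "perm_group {..<2 * p} ?G"
    using tr by (simp add: transitive_perm_group_def)
  show "intersection_density {..<2 * p} ?G \<le> 2"
    using intersection_density_le_2[OF p tr] by simp
  have "even_swaps p \<subseteq> ?G"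
    by (auto simp: even_swaps_def even_shift_swaps_def)
  then have "card (even_swaps p) \<le> Max ?X"
    using intersecting_even_swaps[OF p(2)] finite_intersecting_cards(1)[OF pg] by (intro Max_ge) auto
  \<comment> \<open>The degree \<open>2 * p\<close> meets the index bound \<open>p\<close>: the
    group has at most \<open>p * card (even_swaps p)\<close> elements, which leaves the factor
    2.\<close>
  then have "2 * (p * card (even_swaps p)) \<le> card {..<2 * p} * Max ?X"
    by simp
  then have "2 * card ?G \<le> card {..<2 * p} * Max ?X"
    using card_even_shift_swaps_le[of p] p1 by linarith
  then have "real (2 * card ?G) \<le> real (card {..<2 * p} * Max ?X)"
    by (rule of_nat_mono)
  moreover have "?G \<noteq> {}"
    using pg subgroup.one_closed by (auto simp: perm_group_def)
  then have "card ?G > 0"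
    using perm_group_finite(1)[OF pg] by (simp add: card_gt_0_iff)
  ultimately show "2 \<le> intersection_density {..<2 * p} ?G"
    using intersection_density_transitive[OF tr] p1 by (simp add: le_divide_eq lessThan_empty_iff)
qed

theorem theorem1p9:
  fixes p :: nat
  assumes "prime p" and "odd p"
  shows "max_intersection_density (2 * p) = 2
    \<and> (\<forall>(\<Omega> :: 'a set) G. transitive_perm_group \<Omega> G \<and> card \<Omega> = 2 * p
          \<longrightarrow> intersection_density \<Omega> G \<le> 2)
    \<and> (\<exists>(\<Omega> :: nat set) G. transitive_perm_group \<Omega> G \<and> card \<Omega> = 2 * p
          \<and> intersection_density \<Omega> G = 2)"
proof (intro conjI allI impI)
  have p1: "p > 1"
    using assms(1) by (rule prime_gt_1_nat)
  have ex: "transitive_perm_group {..<2 * p} (even_shift_swaps p)" "card {..<2 * p} = 2 * p"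
    "intersection_density {..<2 * p} (even_shift_swaps p) = 2"
    using transitive_even_shift_swaps intersection_density_even_shift_swaps assms p1 by auto
  then show "\<exists>(\<Omega> :: nat set) G. transitive_perm_group \<Omega> G \<and> card \<Omega> = 2 * p
      \<and> intersection_density \<Omega> G = 2"
    by blast
  show "intersection_density \<Omega> G \<le> 2"
    if "transitive_perm_group \<Omega> G \<and> card \<Omega> = 2 * p" for \<Omega> :: "'a set" and G
    using that intersection_density_le_2[OF assms] by blast
  show "max_intersection_density (2 * p) = 2"
    unfolding max_intersection_density_def
  proof (rule Max_eqI)
    show "finite (transitive_densities (2 * p))"
      using finite_transitive_densities p1 by simp
    show "r \<le> 2" if "r \<in> transitive_densities (2 * p)" for r
      using that intersection_density_le_2[OF assms] by (auto simp: transitive_densities_def)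
    show "2 \<in> transitive_densities (2 * p)"
      unfolding transitive_densities_def using ex by (intro CollectI exI[of _ "{..<2 * p}"] exI[of _ "even_shift_swaps p"]) auto
  qed
qed

end
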